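(* Let $\mathcal{M} = \{(x_1,x_2,x_3) \in \Delta_2 : x_2^2 - x_1 x_3 = 0\}$ be the algebraic model defined by the polynomial $f = x_2^2 - x_1 x_3$. Then $\mathcal{M}$ has ML degree $2$, and yet for every $p \in \mathcal{M}$ the logarithmic Voronoi cell of $p$ is equal to the log-normal polytope at $p$ (up to points in the boundary of the simplex), i.e. $\log \mathrm{Vor}_{\mathcal{M}}(p) = \log N_p\mathcal{M} \cap \Delta_2$.
   Context: $\Delta_{2} = \{u \in \mathbb{R}^3 : u_1+u_2+u_3 = 1,\ u_i > 0\}$ is the open probability simplex and $\overline{\Delta_2}$ its closure. For $u \in \Delta_2$ let $\ell_u(q) = \sum_{i=1}^3 u_i \log(q_i)$. Write $\Phi(u)=p$ if $p \in \mathcal{M}$ and $p \in \operatorname{argmax}_{q \in \mathcal{M}} \ell_u(q)$. The logarithmic Voronoi cell of $p \in \mathcal{M}$ is $\log \mathrm{Vor}_{\mathcal{M}}(p) = \{u \in \Delta_2 : \Phi(u) = p\}$. $N_p\mathcal{M}$ is the orthogonal complement in $\mathbb{R}^3$, for the Euclidean inner product, of the tangent space of $\mathcal{M}$ at $p$. The log-normal space at $p$ is $\log N_p\mathcal{M} = \{u \in \mathbb{R}^3 : \nabla \ell_u(p) \in N_p\mathcal{M}\}$, where $\nabla \ell_u(p) = (u_1/p_1,u_2/p_2,u_3/p_3)$. The log-normal polytope at $p$ is $\log N_p\mathcal{M} \cap \overline{\Delta_2}$. Saying that a logarithmic Voronoi cell equals its log-normal polytope means equality as sets, excepting the points in the boundary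 of the simplex. The ML degree of an algebraic model $\mathcal{M}$ is the number of complex critical points of $\ell_u$ on $\mathcal{M}$ (i.e. on its complex Zariski closure, here the set of complex points with $x_2^2 = x_1x_3$, $x_1+x_2+x_3=1$) for generic data $u \in \Delta_2$; critical points have all coordinates nonzero. *)

theory Defs
  imports "HOL-Analysis.Analysis"
begin

definition open_simplex :: "(real ^ 'n) set" where
  "open_simplex = {u. (\<Sum>i\<in>UNIV. u $ i) = 1 \<and> (\<forall>i. u $ i > 0)}"

definition loglik :: "real ^ 'n \<Rightarrow> real ^ 'n \<Rightarrow> real" where
  "loglik u q = (\<Sum>i\<in>UNIV. u $ i * ln (q $ i))"

text \<open>The gradient of the log-likelihood is polymorphic in the field, since it is also
  needed at complex points; the lemma below identifies it in the real case.\<close>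

definition grad_loglik :: "'a::field ^ 'n \<Rightarrow> 'a ^ 'n \<Rightarrow> 'a ^ 'n" where
  "grad_loglik u x = (\<chi> i. u $ i / x $ i)"

lemma GDERIV_loglik:
  fixes u p :: "real ^ 'n"
  assumes "\<And>i. p $ i > 0"
  shows "GDERIV (loglik u) p :> grad_loglik u p"
proof -
  have "((\<lambda>q. u $ i * ln (q $ i)) has_derivative (\<lambda>h. u $ i * (h $ i / p $ i))) (at p)" for i
    using assms[of i]
    by (auto intro!: derivative_eq_intros bounded_linear_imp_has_derivative
          bounded_linear_vec_nth simp: field_simps)
  then have "((\<lambda>q. \<Sum>i\<in>UNIV. u $ i * ln (q $ i)) has_derivative
      (\<lambda>h. \<Sum>i\<in>UNIV. u $ i * (h $ i / p $ i))) (at p)"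
    by (intro has_derivative_sum) auto
  moreover have "loglik u = (\<lambda>q. \<Sum>i\<in>UNIV. u $ i * ln (q $ i))"
    by (simp add: fun_eq_iff loglik_def)
  moreover have "(\<lambda>h. h \<bullet> grad_loglik u p) = (\<lambda>h. \<Sum>i\<in>UNIV. u $ i * (h $ i / p $ i))"
    by (simp add: fun_eq_iff inner_vec_def grad_loglik_def mult.commute)
  ultimately show ?thesis
    by (simp add: gderiv_def)
qed

text \<open>Polynomial functions over an arbitrary field (the library notion
  \<^const>\<open>real_polynomial_function\<close> covers real values only).\<close>

inductive poly_map :: "('a::field ^ 'n \<Rightarrow> 'a) \<Rightarrow> bool" where
  const: "poly_map (\<lambda>x. c)"
| coord: "poly_map (\<lambda>x. x $ i)"
| add: "poly_map F \<Longrightarrow> poly_map G \<Longrightarrow> poly_map (\<lambda>x. F x + G x)"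
| mult: "poly_map F \<Longrightarrow> poly_map G \<Longrightarrow> poly_map (\<lambda>x. F x * G x)"

definition vanishing_polys :: "('a::field ^ 'n) set \<Rightarrow> ('a ^ 'n \<Rightarrow> 'a) set" where
  "vanishing_polys S = {F. poly_map F \<and> (\<forall>x\<in>S. F x = 0)}"

definition zariski_closure :: "('a::field ^ 'n) set \<Rightarrow> ('a ^ 'n) set" where
  "zariski_closure S = {x. \<forall>F\<in>vanishing_polys S. F x = 0}"

text \<open>The tangent space at a point is the common kernel of the differentials there of all
  polynomials vanishing on the set; the differential of F at x in direction v is the
  derivative at 0 of F along the line through x with direction v.\<close>

definition tangent_space ::
  "('a::real_normed_field ^ 'n) set \<Rightarrow> 'a ^ 'n \<Rightarrow> ('a ^ 'n) set" where
  "tangent_space S x =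
     {v. \<forall>F\<in>vanishing_polys S. ((\<lambda>t. F (x + t *s v)) has_field_derivative 0) (at 0)}"

definition log_voronoi :: "(real ^ 'n) set \<Rightarrow> real ^ 'n \<Rightarrow> (real ^ 'n) set" where
  "log_voronoi M p = {u \<in> open_simplex. is_arg_max (loglik u) (\<lambda>q. q \<in> M) p}"

definition log_normal_space :: "(real ^ 'n) set \<Rightarrow> real ^ 'n \<Rightarrow> (real ^ 'n) set" where
  "log_normal_space M p = {u. grad_loglik u p \<in> orthogonal_comp (tangent_space M p)}"

definition complexify :: "real ^ 'n \<Rightarrow> complex ^ 'n" where
  "complexify x = (\<chi> i. complex_of_real (x $ i))"

text \<open>Critical points are taken on the whole complex Zariski closure. No restriction to its
  regular points is made: the closure is smooth for the model considered here. The pairing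
  with tangent vectors is bilinear, not Hermitian.\<close>

definition critical_points :: "(real ^ 'n) set \<Rightarrow> real ^ 'n \<Rightarrow> (complex ^ 'n) set" where
  "critical_points M u =
     (let X = zariski_closure (complexify ` M) in
      {x \<in> X. (\<forall>i. x $ i \<noteq> 0) \<and>
         (\<forall>v\<in>tangent_space X x.
            (\<Sum>i\<in>UNIV. grad_loglik (complexify u) x $ i * v $ i) = 0)})"

text \<open>Generic data: all data in the simplex off the zero set of a polynomial which does not
  vanish identically on the simplex.\<close>

definition has_ML_degree :: "(real ^ 'n) set \<Rightarrow> nat \<Rightarrow> bool" where
  "has_ML_degree M d \<longleftrightarrow>
     (\<exists>g. poly_map g \<and> (\<exists>u\<in>open_simplex. g u \<noteq> 0) \<and>
        (\<forall>u\<in>open_simplex. g u \<noteq> 0 \<longrightarrow>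
           finite (critical_points M u) \<and> card (critical_points M u) = d))"

definition conic_model :: "(real ^ 3) set" where
  "conic_model = {x \<in> open_simplex. (x $ 2)^2 - x $ 1 * x $ 3 = 0}"

end

theory Submission
  imports Defs
begin

text \<open>
  The model is an exponential family, with weights proportional to
  \<open>1, t, t\<^sup>2\<close>, and everything follows from matching the moment \<open>x\<^sub>2 + 2 x\<^sub>3\<close>.
  In the parametrisation \<open>x = (1, t, t\<^sup>2) / (1 + t + t\<^sup>2)\<close> the logarithmic derivative
  of \<open>x\<^sub>i\<close> with respect to \<open>log t\<close> is \<open>(i - 1) - (x\<^sub>2 + 2 x\<^sub>3)\<close>. Hence the tangent line at
  \<open>x\<close> is spanned by the vector with entries \<open>x\<^sub>i ((i - 1) - (x\<^sub>2 + 2 x\<^sub>3))\<close>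
  (\<open>tangent_space_conic\<close>), and for data \<open>u\<close> of total mass one the point \<open>x\<close> is
  critical exactly when \<open>u\<^sub>2 + 2 u\<^sub>3 = x\<^sub>2 + 2 x\<^sub>3\<close> (\<open>score_zero_iff_moments_agree\<close>). This holds
  over the reals and over the complex numbers alike.

  The conic and the linear moment equation together reduce to
  \<open>3 y\<^sup>2 + 2 y = m (2 - m)\<close> for \<open>y = x\<^sub>2\<close>, where \<open>m = u\<^sub>2 + 2 u\<^sub>3\<close>. For data in the open
  simplex \<open>0 < m < 2\<close>, so that this quadratic has a positive and a negative root. The count
  of two critical points therefore holds for all data in the open simplex, and the constant
  polynomial 1 serves as the genericity condition.

  On the model, \<open>log q\<^sub>i\<close> is an affine function of \<open>i\<close>, so that the
  log-likelihood depends on \<open>u\<close> only through the moment. If \<open>u\<close> and \<open>p\<close> have the same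
  moment, then \<open>u\<close> may be replaced by \<open>p\<close>, and \<open>p\<close> is a maximiser by Gibbs'
  inequality. Thus every critical point in the model is a global maximum, although there is a
  second critical point, which lies outside the simplex.
\<close>

section \<open>The conic and its parametrisation\<close>

definition conic :: "('a::field ^ 3) set" where
  "conic = {x. x $ 1 + x $ 2 + x $ 3 = 1 \<and> (x $ 2)^2 = x $ 1 * x $ 3}"

definition conic_point :: "'a::field \<Rightarrow> 'a ^ 3" where
  "conic_point t = vector [1 / (1 + t + t^2), t / (1 + t + t^2), t^2 / (1 + t + t^2)]"

definition moment :: "'a::field ^ 3 \<Rightarrow> 'a" where
  "moment x = x $ 2 + 2 * x $ 3"

lemma conic_point_nth [simp]:
  "conic_point t $ 1 = 1 / (1 + t + t^2)"
  "conic_point t $ 2 = t / (1 + t + t^2)"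
  "conic_point t $ 3 = t^2 / (1 + t + t^2)"
  by (simp_all add: conic_point_def)

lemma conic_eq_conic_point:
  fixes x :: "'a::field ^ 3"
  assumes "x \<in> conic" "x $ 1 \<noteq> 0"
  defines "t \<equiv> x $ 2 / x $ 1"
  shows "1 + t + t^2 \<noteq> 0" "x = conic_point t"
proof -
  have sum1: "x $ 1 + x $ 2 + x $ 3 = 1" and quad: "(x $ 2)^2 = x $ 1 * x $ 3"
    using assms(1) by (auto simp: conic_def)
  have t2: "t^2 = x $ 3 / x $ 1"
    using assms(2) quad by (simp add: t_def power_divide power2_eq_square)
  have "1 + t + t^2 = (x $ 1 + x $ 2 + x $ 3) / x $ 1"
    unfolding t2 using assms(2) by (simp add: t_def add_divide_distrib)
  then have s: "1 + t + t^2 = 1 / x $ 1"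
    by (simp add: sum1)
  then show "1 + t + t^2 \<noteq> 0"
    using assms(2) by simp
  show "x = conic_point t"
    unfolding vec_eq_iff forall_3 conic_point_nth s unfolding t2
    using assms(2) by (simp add: t_def)
qed

lemma conic_model_iff:
  "x \<in> conic_model \<longleftrightarrow> x \<in> conic \<and> x $ 1 > 0 \<and> x $ 2 > 0 \<and> x $ 3 > 0"
  by (auto simp: conic_model_def conic_def open_simplex_def sum_3 forall_3)

lemma conic_point_in_conic_model:
  fixes t :: real
  assumes "t > 0"
  shows "conic_point t \<in> conic_model"
proof -
  have s: "1 + t + t^2 > 0"
    using assms by (simp add: add_pos_pos)
  then have "1 / (1 + t + t^2) + t / (1 + t + t^2) + t^2 / (1 + t + t^2) = 1"
    by (simp flip: add_divide_distrib)
  then show ?thesis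
    using assms s by (auto simp: conic_model_iff conic_def power_divide power2_eq_square)
qed

lemma conic_model_eq_conic_point:
  assumes "x \<in> conic_model"
  obtains t where "t > 0" "x = conic_point t"
proof (rule that)
  show "x $ 2 / x $ 1 > 0" "x = conic_point (x $ 2 / x $ 1)"
    using conic_eq_conic_point(2)[of x] assms by (auto simp: conic_model_iff)
qed

lemma complexify_conic_point: "complexify (conic_point t) = conic_point (complex_of_real t)"
  by (simp add: vec_eq_iff forall_3 complexify_def)

section \<open>Polynomials along curves\<close>

text \<open>A chain rule in just the form needed for comparing a polynomial on a line with the same
  polynomial on a curve: at each point there is one functional \<open>D\<close> that gives the
  derivative along every curve through that point.\<close>

lemma poly_map_derivative_along_curves:
  fixes F :: "'a::real_normed_field ^ 'n \<Rightarrow> 'a"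
  assumes "poly_map F"
  shows "\<exists>D. \<forall>c c' z. c z = x \<longrightarrow> (\<forall>i. ((\<lambda>t. c t $ i) has_field_derivative c' $ i) (at z)) \<longrightarrow>
           ((\<lambda>t. F (c t)) has_field_derivative D c') (at z)"
  using assms
proof induction
  case (const c)
  show ?case by (intro exI[of _ "\<lambda>_. 0"]) auto
next
  case (coord i)
  show ?case by (intro exI[of _ "\<lambda>v. v $ i"]) auto
next
  case (add F G)
  then obtain D E where
    D: "\<And>c c' z. c z = x \<Longrightarrow> (\<forall>i. ((\<lambda>t. c t $ i) has_field_derivative c' $ i) (at z)) \<Longrightarrow>
           ((\<lambda>t. F (c t)) has_field_derivative D c') (at z)" and
    E: "\<And>c c' z. c z = x \<Longrightarrow> (\<forall>i. ((\<lambda>t. c t $ i) has_field_derivative c' $ i) (at z)) \<Longrightarrow>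
           ((\<lambda>t. G (c t)) has_field_derivative E c') (at z)"
    by metis
  show ?case
    by (intro exI[of _ "\<lambda>v. D v + E v"]) (auto intro!: DERIV_add D E)
next
  case (mult F G)
  then obtain D E where
    D: "\<And>c c' z. c z = x \<Longrightarrow> (\<forall>i. ((\<lambda>t. c t $ i) has_field_derivative c' $ i) (at z)) \<Longrightarrow>
           ((\<lambda>t. F (c t)) has_field_derivative D c') (at z)" and
    E: "\<And>c c' z. c z = x \<Longrightarrow> (\<forall>i. ((\<lambda>t. c t $ i) has_field_derivative c' $ i) (at z)) \<Longrightarrow>
           ((\<lambda>t. G (c t)) has_field_derivative E c') (at z)"
    by metis
  show ?case
  proof (intro exI[of _ "\<lambda>v. D v * G x + E v * F x"] allI impI)
    fix c :: "'a \<Rightarrow> 'a ^ 'n" and c' z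
    assume "c z = x" "\<forall>i. ((\<lambda>t. c t $ i) has_field_derivative c' $ i) (at z)"
    then show "((\<lambda>t. F (c t) * G (c t)) has_field_derivative D c' * G x + E c' * F x) (at z)"
      using DERIV_mult[OF D[of c z c'] E[of c z c']] by simp
  qed
qed

lemma poly_map_on_conic_point:
  fixes F :: "'a::field ^ 3 \<Rightarrow> 'a"
  assumes "poly_map F"
  shows "\<exists>p N. \<forall>t. 1 + t + t^2 \<noteq> 0 \<longrightarrow> F (conic_point t) * (1 + t + t^2) ^ N = poly p t"
  using assms
proof induction
  case (const c)
  show ?case by (intro exI[of _ "[:c:]"] exI[of _ 0]) simp
next
  case (coord i)
  consider "i = 1" | "i = 2" | "i = 3" using exhaust_3 by blast
  then show ?case
  proof cases
    case 1
    then show ?thesis by (intro exI[of _ "1"] exI[of _ 1]) simp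
  next
    case 2
    then show ?thesis by (intro exI[of _ "[:0, 1:]"] exI[of _ 1]) simp
  next
    case 3
    then show ?thesis
      by (intro exI[of _ "[:0, 0, 1:]"] exI[of _ 1]) (simp add: power2_eq_square)
  qed
next
  case (add F G)
  then obtain p N q M where
    p: "\<And>t. 1 + t + t^2 \<noteq> 0 \<Longrightarrow> F (conic_point t) * (1 + t + t^2) ^ N = poly p t" and
    q: "\<And>t. 1 + t + t^2 \<noteq> 0 \<Longrightarrow> G (conic_point t) * (1 + t + t^2) ^ M = poly q t"
    by metis
  have s: "poly [:1, 1, 1:] t = 1 + t + t^2" for t :: 'a
    by (simp add: power2_eq_square algebra_simps)
  have "(F (conic_point t) + G (conic_point t)) * (1 + t + t^2) ^ (N + M)
      = poly (p * [:1, 1, 1:] ^ M + q * [:1, 1, 1:] ^ N) t" if "1 + t + t^2 \<noteq> 0" for t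
    unfolding poly_add poly_mult poly_power s p[OF that, symmetric] q[OF that, symmetric]
    by (simp add: power_add algebra_simps)
  then show ?case by blast
next
  case (mult F G)
  then obtain p N q M where
    p: "\<And>t. 1 + t + t^2 \<noteq> 0 \<Longrightarrow> F (conic_point t) * (1 + t + t^2) ^ N = poly p t" and
    q: "\<And>t. 1 + t + t^2 \<noteq> 0 \<Longrightarrow> G (conic_point t) * (1 + t + t^2) ^ M = poly q t"
    by metis
  have "(F (conic_point t) * G (conic_point t)) * (1 + t + t^2) ^ (N + M) = poly (p * q) t"
    if "1 + t + t^2 \<noteq> 0" for t
    unfolding poly_mult p[OF that, symmetric] q[OF that, symmetric]
    by (simp add: power_add algebra_simps)
  then show ?case by blast
qed

section \<open>Zariski closure and tangent lines\<close>

text \<open>The real arc of the model is Zariski dense in the parametrised part of the conic: after clearing denominators, a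
  polynomial restricted to the parametrised curve becomes a polynomial in \<open>t\<close>, and the
  positive reals are already too many roots.\<close>

lemma vanishing_polys_conic_point:
  fixes S :: "('a::real_normed_field ^ 3) set"
  assumes arc: "\<And>r. r > 0 \<Longrightarrow> conic_point (of_real r) \<in> S"
    and F: "F \<in> vanishing_polys S" and t: "1 + t + t^2 \<noteq> 0"
  shows "F (conic_point t) = 0"
proof -
  obtain p N where
    p: "\<And>t. 1 + t + t^2 \<noteq> 0 \<Longrightarrow> F (conic_point t) * (1 + t + t^2) ^ N = poly p t"
    using poly_map_on_conic_point[of F] F by (auto simp: vanishing_polys_def)
  have "poly p (of_real r) = 0" if "r > 0" for r
  proof -
    have "1 + r + r^2 > 0"
      using that by (simp add: add_pos_pos)
    moreover have "1 + of_real r + (of_real r)^2 = (of_real (1 + r + r^2) :: 'a)"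
      by simp
    ultimately have "1 + of_real r + (of_real r)^2 \<noteq> (0 :: 'a)"
      by (metis less_irrefl of_real_eq_0_iff)
    then show ?thesis
      using p[of "of_real r"] arc[OF that] F by (auto simp: vanishing_polys_def)
  qed
  then have "of_real ` {0<..} \<subseteq> {x :: 'a. poly p x = 0}"
    by auto
  moreover have "infinite (of_real ` {0::real<..} :: 'a set)"
    using infinite_Ioi by (subst finite_image_iff) (auto simp: inj_on_def)
  ultimately have "p = 0"
    using poly_roots_finite finite_subset by blast
  then show ?thesis
    using p[OF t] t by simp
qed

lemma conic_equations_vanish:
  fixes S :: "('a::field ^ 3) set"
  assumes "S \<subseteq> conic"
  shows "(\<lambda>x. x $ 2 * x $ 2 + (- 1) * (x $ 1 * x $ 3)) \<in> vanishing_polys S"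
    and "(\<lambda>x. x $ 1 + (x $ 2 + (x $ 3 + (- 1)))) \<in> vanishing_polys S"
proof -
  have "poly_map (\<lambda>x :: 'a ^ 3. x $ 2 * x $ 2 + (- 1) * (x $ 1 * x $ 3))"
    and "poly_map (\<lambda>x :: 'a ^ 3. x $ 1 + (x $ 2 + (x $ 3 + (- 1))))"
    by (intro poly_map.intros)+
  moreover have "x $ 2 * x $ 2 + (- 1) * (x $ 1 * x $ 3) = 0"
    and "x $ 1 + (x $ 2 + (x $ 3 + (- 1))) = 0" if "x \<in> S" for x
    using assms that unfolding conic_def by (auto simp: power2_eq_square algebra_simps)
  ultimately show "(\<lambda>x. x $ 2 * x $ 2 + (- 1) * (x $ 1 * x $ 3)) \<in> vanishing_polys S"
    and "(\<lambda>x. x $ 1 + (x $ 2 + (x $ 3 + (- 1)))) \<in> vanishing_polys S"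
    unfolding vanishing_polys_def by blast+
qed

lemma zariski_closure_subset_conic:
  fixes S :: "('a::field ^ 3) set"
  assumes "S \<subseteq> conic"
  shows "zariski_closure S \<subseteq> conic"
proof
  fix x assume "x \<in> zariski_closure S"
  then have "F x = 0" if "F \<in> vanishing_polys S" for F
    using that by (simp add: zariski_closure_def)
  from this[OF conic_equations_vanish(1)[OF assms]] this[OF conic_equations_vanish(2)[OF assms]]
  show "x \<in> conic"
    by (auto simp: conic_def power2_eq_square algebra_simps)
qed

lemma tangent_spaceD:
  assumes "v \<in> tangent_space S x" "F \<in> vanishing_polys S"
  shows "((\<lambda>t. F (x + t *s v)) has_field_derivative 0) (at 0)"
  using assms by (simp add: tangent_space_def)

lemma vanishing_polys_zariski_closure: "vanishing_polys (zariski_closure S) = vanishing_polys S"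
  by (auto simp: vanishing_polys_def zariski_closure_def)

lemma tangent_space_zariski_closure: "tangent_space (zariski_closure S) x = tangent_space S x"
  by (simp add: tangent_space_def vanishing_polys_zariski_closure)

text \<open>The logarithmic derivative of the parametrisation: moving \<open>t\<close> at relative speed
  \<open>k\<close> moves the coordinate \<open>x\<^sub>i\<close> at relative speed \<open>k ((i - 1) - moment x)\<close>.\<close>

definition conic_tangent :: "'a::field ^ 3 \<Rightarrow> 'a ^ 3" where
  "conic_tangent x = vector [x $ 1 * (0 - moment x), x $ 2 * (1 - moment x), x $ 3 * (2 - moment x)]"

lemma conic_tangent_nth [simp]:
  "conic_tangent x $ 1 = x $ 1 * (0 - moment x)"
  "conic_tangent x $ 2 = x $ 2 * (1 - moment x)"
  "conic_tangent x $ 3 = x $ 3 * (2 - moment x)"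
  by (simp_all add: conic_tangent_def)

lemma conic_point_derivative:
  fixes t k :: "'a::real_normed_field"
  assumes s: "1 + t + t^2 \<noteq> 0"
  shows "((\<lambda>z. conic_point (t + t * k * z) $ i) has_field_derivative
           (k *s conic_tangent (conic_point t)) $ i) (at 0)"
proof -
  define w where "w = 1 + t + t^2"
  have w: "w \<noteq> 0"
    using s by (simp add: w_def)
  define x where "x = conic_point t"
  have nth: "x $ 1 = 1 / w" "x $ 2 = t / w" "x $ 3 = t^2 / w"
    by (simp_all add: x_def w_def)
  have m: "moment x = (t + 2 * t^2) / w"
    by (simp add: moment_def nth add_divide_distrib)
  have am: "a - moment x = (a * w - (t + 2 * t^2)) / w" for a
    using w unfolding m by (simp add: diff_divide_distrib)
  have assoc: "k * (a / w * (b / w)) = (k * a * b) / (w * w)" for a b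
    by simp
  have "((\<lambda>z. 1 + (t + t * k * z) + (t + t * k * z)^2) has_field_derivative
      t * k * (1 + 2 * t)) (at 0)"
    by (auto intro!: derivative_eq_intros simp: algebra_simps)
  from DERIV_divide[OF _ this] s
  have quot: "((\<lambda>z. f z / (1 + (t + t * k * z) + (t + t * k * z)^2)) has_field_derivative
      (f' * w - f 0 * (t * k * (1 + 2 * t))) / (w * w)) (at 0)"
    if "(f has_field_derivative f') (at 0)" for f f'
    using that by (simp add: w_def)
  have lin: "((\<lambda>z. t + t * k * z) has_field_derivative t * k) (at 0)"
    by (auto intro!: derivative_eq_intros)
  have sq: "((\<lambda>z. (t + t * k * z)^2) has_field_derivative 2 * t * (t * k)) (at 0)"
    by (auto intro!: derivative_eq_intros)
  consider "i = 1" | "i = 2" | "i = 3" using exhaust_3 by blast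
  then show ?thesis
  proof cases
    case 1
    show ?thesis
      unfolding 1 vector_smult_component conic_tangent_nth conic_point_nth(1)
        x_def[symmetric] am nth assoc
      by (rule DERIV_cong[OF quot[OF DERIV_const]])
        (simp add: algebra_simps power2_eq_square)
  next
    case 2
    show ?thesis
      unfolding 2 vector_smult_component conic_tangent_nth conic_point_nth(2)
        x_def[symmetric] am nth assoc
      by (rule DERIV_cong[OF quot[OF lin]]) (simp add: algebra_simps power2_eq_square)
  next
    case 3
    show ?thesis
      unfolding 3 vector_smult_component conic_tangent_nth conic_point_nth(3)
        x_def[symmetric] am nth assoc
      by (rule DERIV_cong[OF quot[OF sq]]) (simp add: algebra_simps power2_eq_square)
  qed
qed

text \<open>The two equations of the conic cut the tangent space down to a line, and the velocity of
  the parametrisation, along which every vanishing polynomial is constant, fills that line.\<close>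

lemma tangent_space_conic:
  fixes S :: "('a::real_normed_field ^ 3) set"
  assumes S: "S \<subseteq> conic" and arc: "\<And>r. r > 0 \<Longrightarrow> conic_point (of_real r) \<in> S"
    and x: "x \<in> conic" "x $ 1 \<noteq> 0" "x $ 2 \<noteq> 0" "x $ 3 \<noteq> 0"
  shows "tangent_space S x = range (\<lambda>k. k *s conic_tangent x)"
proof (intro equalityI subsetI)
  fix v assume v: "v \<in> tangent_space S x"
  have sum1: "x $ 1 + x $ 2 + x $ 3 = 1" and quad: "x $ 2 * x $ 2 = x $ 1 * x $ 3"
    using x(1) by (auto simp: conic_def power2_eq_square)
  have "((\<lambda>t. (x + t *s v) $ 2 * (x + t *s v) $ 2 + (- 1) * ((x + t *s v) $ 1 * (x + t *s v) $ 3))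
          has_field_derivative 0) (at 0)"
    by (rule tangent_spaceD[OF v conic_equations_vanish(1)[OF S]])
  moreover have "((\<lambda>t. (x + t *s v) $ 2 * (x + t *s v) $ 2
            + (- 1) * ((x + t *s v) $ 1 * (x + t *s v) $ 3))
          has_field_derivative (2 * x $ 2 * v $ 2 - (v $ 1 * x $ 3 + x $ 1 * v $ 3))) (at 0)"
    by (auto intro!: derivative_eq_intros simp: algebra_simps)
  ultimately have dquad: "2 * x $ 2 * v $ 2 - (v $ 1 * x $ 3 + x $ 1 * v $ 3) = 0"
    using DERIV_unique by blast
  have "((\<lambda>t. (x + t *s v) $ 1 + ((x + t *s v) $ 2 + ((x + t *s v) $ 3 + (- 1))))
          has_field_derivative 0) (at 0)"
    by (rule tangent_spaceD[OF v conic_equations_vanish(2)[OF S]])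
  moreover have "((\<lambda>t. (x + t *s v) $ 1 + ((x + t *s v) $ 2 + ((x + t *s v) $ 3 + (- 1))))
          has_field_derivative (v $ 1 + v $ 2 + v $ 3)) (at 0)"
    by (auto intro!: derivative_eq_intros simp: algebra_simps)
  ultimately have dsum: "v $ 1 + v $ 2 + v $ 3 = 0"
    using DERIV_unique by blast
  \<comment> \<open>In terms of the relative velocities, the differentiated equation of the conic says that
    they form an arithmetic progression; \<open>k\<close> is its common difference.\<close>
  define a where "a = v $ 1 / x $ 1"
  define k where "k = v $ 2 / x $ 2 - a"
  have v1: "v $ 1 = x $ 1 * a" and v2: "v $ 2 = x $ 2 * (a + k)"
    using x by (simp_all add: a_def k_def)
  have "x $ 1 * v $ 3 = x $ 1 * (x $ 3 * (a + 2 * k))"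
    using dquad quad unfolding v1 v2 by algebra
  then have v3: "v $ 3 = x $ 3 * (a + 2 * k)"
    using x by simp
  have a: "a = - k * moment x"
    using dsum sum1 unfolding v1 v2 v3 moment_def by algebra
  have "v = k *s conic_tangent x"
    by (simp add: vec_eq_iff forall_3 v1 v2 v3 a algebra_simps)
  then show "v \<in> range (\<lambda>k. k *s conic_tangent x)"
    by blast
next
  fix v assume "v \<in> range (\<lambda>k. k *s conic_tangent x)"
  then obtain k where v: "v = k *s conic_tangent x"
    by blast
  obtain t where s: "1 + t + t^2 \<noteq> 0" and t: "x = conic_point t"
    by (rule that[OF conic_eq_conic_point[OF x(1,2)]])
  show "v \<in> tangent_space S x"
    unfolding tangent_space_def
  proof (intro CollectI ballI)
    fix F assume F: "F \<in> vanishing_polys S"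
    then obtain D where D: "\<And>c c' z. c z = x \<Longrightarrow>
        (\<forall>i. ((\<lambda>t. c t $ i) has_field_derivative c' $ i) (at z)) \<Longrightarrow>
        ((\<lambda>t. F (c t)) has_field_derivative D c') (at z)"
      using poly_map_derivative_along_curves[of F x] by (auto simp: vanishing_polys_def)
    have line: "((\<lambda>z. F (x + z *s v)) has_field_derivative D v) (at 0)"
      by (rule D) (auto intro!: derivative_eq_intros simp: vec_eq_iff)
    have curve: "((\<lambda>z. F (conic_point (t + t * k * z))) has_field_derivative D v) (at 0)"
      by (rule D) (use conic_point_derivative[OF s] in \<open>auto simp: t v\<close>)
    have "((\<lambda>z. 1 + (t + t * k * z) + (t + t * k * z)^2) \<longlongrightarrow> 1 + (t + t * k * 0) + (t + t * k * 0)^2)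
        (nhds 0)"
      by (intro tendsto_intros filterlim_ident)
    then have "\<forall>\<^sub>F z in nhds 0. 1 + (t + t * k * z) + (t + t * k * z)^2 \<noteq> 0"
      by (rule tendsto_imp_eventually_ne) (use s in simp)
    then have "\<forall>\<^sub>F z in nhds 0. F (conic_point (t + t * k * z)) = 0"
      by (rule eventually_mono) (rule vanishing_polys_conic_point[OF arc F])
    from iffD1[OF DERIV_cong_ev[OF refl this refl] curve]
    have "((\<lambda>z. 0) has_field_derivative D v) (at 0)" .
    then have "D v = 0"
      using DERIV_unique DERIV_const by blast
    then show "((\<lambda>z. F (x + z *s v)) has_field_derivative 0) (at 0)"
      using line by simp
  qed
qed

lemma score_zero_iff_moments_agree:
  fixes S :: "('a::real_normed_field ^ 3) set"
  assumes S: "S \<subseteq> conic" and arc: "\<And>r. r > 0 \<Longrightarrow> conic_point (of_real r) \<in> S"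
    and x: "x \<in> conic" "x $ 1 \<noteq> 0" "x $ 2 \<noteq> 0" "x $ 3 \<noteq> 0"
    and u: "u $ 1 + u $ 2 + u $ 3 = 1"
  shows "(\<forall>v\<in>tangent_space S x. (\<Sum>i\<in>UNIV. grad_loglik u x $ i * v $ i) = 0)
           \<longleftrightarrow> moment u = moment x"
proof -
  have "(\<Sum>i\<in>UNIV. grad_loglik u x $ i * (k *s conic_tangent x) $ i)
      = k * (u $ 1 * (0 - moment x) + u $ 2 * (1 - moment x) + u $ 3 * (2 - moment x))" for k
  proof -
    have cancel: "a / b * (k * (b * c)) = k * (a * c)" if "b \<noteq> 0" for a b c
      using that by simp
    show ?thesis
      by (simp only: sum_3 grad_loglik_def vec_lambda_beta vector_smult_component
          conic_tangent_nth distrib_left cancel[OF x(2)] cancel[OF x(3)] cancel[OF x(4)])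
  qed
  also have "k * (u $ 1 * (0 - moment x) + u $ 2 * (1 - moment x) + u $ 3 * (2 - moment x))
      = k * (moment u - moment x)" for k
    using u unfolding moment_def by algebra
  finally have eq: "(\<Sum>i\<in>UNIV. grad_loglik u x $ i * (k *s conic_tangent x) $ i)
      = k * (moment u - moment x)" for k .
  have "(\<forall>v\<in>tangent_space S x. (\<Sum>i\<in>UNIV. grad_loglik u x $ i * v $ i) = 0)
      \<longleftrightarrow> (\<forall>k. k * (moment u - moment x) = 0)"
    by (simp add: tangent_space_conic[OF S arc x] eq del: mult_eq_0_iff vector_smult_component)
  then show ?thesis
    by (metis eq_iff_diff_eq_0 mult_1 mult_zero_right)
qed

section \<open>Counting the complex critical points\<close>

lemma open_simplex_sum: "u \<in> open_simplex \<Longrightarrow> u $ 1 + u $ 2 + u $ 3 = 1" for u :: "real ^ 3"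
  by (simp add: open_simplex_def sum_3)

lemma moment_bounds:
  fixes u :: "real ^ 3"
  assumes "u \<in> open_simplex"
  shows "0 < moment u" "moment u < 2"
proof -
  have "u $ 1 > 0" "u $ 2 > 0" "u $ 3 > 0"
    using assms by (auto simp: open_simplex_def)
  then show "0 < moment u" "moment u < 2"
    using open_simplex_sum[OF assms] by (auto simp: moment_def)
qed

lemma critical_points_conic_model:
  assumes u: "u \<in> open_simplex"
  shows "critical_points conic_model u =
    {x \<in> conic. x $ 2 \<noteq> 0 \<and> moment x = complex_of_real (moment u)}"
proof -
  let ?S = "complexify ` conic_model"
  have S: "?S \<subseteq> conic"
  proof
    fix x assume "x \<in> ?S"
    then obtain y where y: "y \<in> conic" "x = complexify y"
      by (auto simp: conic_model_iff)
    have "complex_of_real (y $ 1 + y $ 2 + y $ 3) = 1"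
      "complex_of_real ((y $ 2)^2) = of_real (y $ 1 * y $ 3)"
      using y(1) unfolding conic_def by (simp_all only: mem_Collect_eq of_real_1)
    then show "x \<in> conic"
      by (simp add: y(2) conic_def complexify_def)
  qed
  have arc: "conic_point (of_real r) \<in> ?S" if "r > 0" for r
    using conic_point_in_conic_model[OF that] complexify_conic_point by (metis imageI)
  have sum: "complexify u $ 1 + complexify u $ 2 + complexify u $ 3 = 1"
    using open_simplex_sum[OF u] by (simp add: complexify_def flip: of_real_add)
  have mom: "moment (complexify u) = complex_of_real (moment u)"
    by (simp add: moment_def complexify_def)
  have closure: "x \<in> zariski_closure ?S \<longleftrightarrow> x \<in> conic" if "x $ 1 \<noteq> 0" for x
  proof
    assume "x \<in> conic"
    then obtain t where "1 + t + t^2 \<noteq> 0" "x = conic_point t"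
      using conic_eq_conic_point[of x] \<open>x $ 1 \<noteq> 0\<close> by metis
    then show "x \<in> zariski_closure ?S"
      using vanishing_polys_conic_point[OF arc] by (auto simp: zariski_closure_def)
  qed (use zariski_closure_subset_conic[OF S] in blast)
  have nonzero: "x $ 1 \<noteq> 0 \<and> x $ 2 \<noteq> 0 \<and> x $ 3 \<noteq> 0 \<longleftrightarrow> x $ 2 \<noteq> 0" if "x \<in> conic" for x :: "complex^3"
    using that by (auto simp: conic_def)
  have "x \<in> critical_points conic_model u \<longleftrightarrow>
      x \<in> conic \<and> x $ 2 \<noteq> 0 \<and> moment x = complex_of_real (moment u)" for x
    using score_zero_iff_moments_agree[OF S arc _ _ _ _ sum, of x] closure[of x] nonzero[of x]
    by (auto simp: critical_points_def Let_def tangent_space_zariski_closure forall_3 mom)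
  then show ?thesis by blast
qed

text \<open>The total mass and the moment express \<open>x\<^sub>1\<close> and \<open>x\<^sub>3\<close> linearly through \<open>x\<^sub>2\<close>, which
  turns the equation of the conic into one quadratic equation for \<open>x\<^sub>2\<close>.\<close>

lemma conic_with_moment_iff:
  fixes x :: "'a::field_char_0 ^ 3"
  shows "x \<in> conic \<and> moment x = m \<longleftrightarrow>
    x = vector [(2 - m - x $ 2) / 2, x $ 2, (m - x $ 2) / 2] \<and>
    3 * (x $ 2)^2 + 2 * x $ 2 = m * (2 - m)"
proof -
  define a b c where "a = x $ 1" and "b = x $ 2" and "c = x $ 3"
  have half: "z = w / 2 \<longleftrightarrow> 2 * z = w" for z w :: 'a
    by (simp add: eq_divide_eq mult.commute)
  have "(a + b + c = 1 \<and> b^2 = a * c) \<and> b + 2 * c = m \<longleftrightarrow>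
      (2 * a = 2 - m - b \<and> 2 * c = m - b) \<and> 3 * b^2 + 2 * b = m * (2 - m)"
  proof (intro iffI conjI; (elim conjE)?)
    assume sum: "a + b + c = 1" and quad: "b^2 = a * c" and mom: "b + 2 * c = m"
    show "2 * a = 2 - m - b" "2 * c = m - b" "3 * b^2 + 2 * b = m * (2 - m)"
      using sum quad mom by algebra+
  next
    assume a: "2 * a = 2 - m - b" and c: "2 * c = m - b" and quad: "3 * b^2 + 2 * b = m * (2 - m)"
    have "2 * (a + b + c) = 2 * 1" "4 * b^2 = 4 * (a * c)"
      using a c quad by algebra+
    then show "a + b + c = 1" "b^2 = a * c"
      unfolding mult_left_cancel[OF zero_neq_numeral[symmetric]] .
    show "b + 2 * c = m"
      using c by algebra
  qed
  then show ?thesis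
    by (simp add: vec_eq_iff forall_3 half conic_def moment_def a_def b_def c_def mult.commute)
qed

lemma card_critical_points_conic_model:
  assumes u: "u \<in> open_simplex"
  shows "finite (critical_points conic_model u) \<and> card (critical_points conic_model u) = 2"
proof -
  define m where "m = moment u"
  define d where "d = sqrt (1 + 3 * (m * (2 - m)))"
  have "m * (2 - m) > 0"
    using moment_bounds[OF u] by (simp add: m_def)
  then have d: "d > 1" "d^2 = 1 + 3 * (m * (2 - m))"
    by (simp_all add: d_def)
  define P where "P = (\<lambda>y :: complex. vector [(2 - of_real m - y) / 2, y, (of_real m - y) / 2] :: complex ^ 3)"
  define y1 y2 where "y1 = complex_of_real ((d - 1) / 3)" and "y2 = complex_of_real ((- d - 1) / 3)"
  have dc: "complex_of_real d ^ 2 = 1 + 3 * (of_real m * (2 - of_real m))"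
    using arg_cong[OF d(2), of complex_of_real] by simp
  have ne: "y1 \<noteq> y2" "y1 \<noteq> 0" "y2 \<noteq> 0"
    using d(1) unfolding y1_def y2_def of_real_eq_iff of_real_eq_0_iff by simp_all
  have roots: "3 * y^2 + 2 * y = of_real m * (2 - of_real m) \<longleftrightarrow> y = y1 \<or> y = y2" for y
  proof -
    have "3 * ((y - y1) * (y - y2)) = 3 * y^2 + 2 * y + (1 - (of_real d)^2) / 3"
      by (simp add: y1_def y2_def field_simps power2_eq_square)
    also have "\<dots> = 3 * y^2 + 2 * y - of_real m * (2 - of_real m)"
      by (simp add: dc)
    finally have "3 * y^2 + 2 * y - of_real m * (2 - of_real m) = 3 * ((y - y1) * (y - y2))"
      by simp
    then show ?thesis
      by (metis eq_iff_diff_eq_0 mult_eq_0_iff zero_neq_numeral)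
  qed
  have P2: "P y $ 2 = y" for y
    by (simp add: P_def)
  have "x \<in> critical_points conic_model u \<longleftrightarrow> x = P y1 \<or> x = P y2" for x
  proof -
    have "x \<in> critical_points conic_model u \<longleftrightarrow> x $ 2 \<noteq> 0 \<and> x \<in> conic \<and> moment x = of_real m"
      unfolding critical_points_conic_model[OF u] m_def by blast
    also have "\<dots> \<longleftrightarrow> x $ 2 \<noteq> 0 \<and> x = P (x $ 2) \<and> (x $ 2 = y1 \<or> x $ 2 = y2)"
      unfolding conic_with_moment_iff roots P_def ..
    finally show ?thesis
      using ne P2 by metis
  qed
  then have "critical_points conic_model u = {P y1, P y2}"
    by blast
  moreover have "P y1 \<noteq> P y2"
    using ne(1) P2 by metis
  ultimately show ?thesis
    by simp
qed

section \<open>Maximum likelihood on the model\<close>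

text \<open>On the model the moment is a sufficient statistic.\<close>

lemma loglik_conic_point:
  fixes t :: real
  assumes "t > 0" and u: "u $ 1 + u $ 2 + u $ 3 = 1"
  shows "loglik u (conic_point t) = moment u * ln t - ln (1 + t + t^2)"
proof -
  let ?s = "1 + t + t^2"
  have "?s > 0"
    using assms(1) by (simp add: add_pos_pos)
  then have "loglik u (conic_point t) =
      u $ 1 * (- ln ?s) + u $ 2 * (ln t - ln ?s) + u $ 3 * (2 * ln t - ln ?s)"
    using assms(1) by (simp add: loglik_def sum_3 ln_div ln_realpow)
  also have "\<dots> = moment u * ln t - (u $ 1 + u $ 2 + u $ 3) * ln ?s"
    by (simp add: moment_def algebra_simps)
  finally show ?thesis
    by (simp add: u)
qed

lemma Gibbs_inequality:
  fixes p q :: "real ^ 'n"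
  assumes p: "p \<in> open_simplex" and q: "q \<in> open_simplex"
  shows "loglik p q \<le> loglik p p"
proof -
  have "p $ i * ln (q $ i) - p $ i * ln (p $ i) \<le> q $ i - p $ i" for i
  proof -
    have pos: "p $ i > 0" "q $ i > 0"
      using p q by (auto simp: open_simplex_def)
    then have "p $ i * ln (q $ i / p $ i) \<le> p $ i * (q $ i / p $ i - 1)"
      by (intro mult_left_mono ln_le_minus_one) auto
    then show ?thesis
      using pos by (simp add: ln_div algebra_simps)
  qed
  then have "loglik p q - loglik p p \<le> (\<Sum>i\<in>UNIV. q $ i - p $ i)"
    unfolding loglik_def sum_subtractf[symmetric] by (intro sum_mono) auto
  also have "\<dots> = 0"
    using p q by (simp add: open_simplex_def sum_subtractf)
  finally show ?thesis
    by simp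
qed

lemma is_arg_max_iff_moments_agree:
  assumes u: "u \<in> open_simplex" and p: "p \<in> conic_model"
  shows "is_arg_max (loglik u) (\<lambda>q. q \<in> conic_model) p \<longleftrightarrow> moment u = moment p"
proof
  have simplex: "q \<in> open_simplex" if "q \<in> conic_model" for q
    using that by (simp add: conic_model_def)
  assume m: "moment u = moment p"
  have same: "loglik u q = loglik p q" if "q \<in> conic_model" for q
    using conic_model_eq_conic_point[OF that] loglik_conic_point open_simplex_sum u m
      simplex[OF p] by metis
  show "is_arg_max (loglik u) (\<lambda>q. q \<in> conic_model) p"
    using Gibbs_inequality[OF simplex[OF p] simplex] same p
    by (auto simp: is_arg_max_def not_less)
next
  assume max: "is_arg_max (loglik u) (\<lambda>q. q \<in> conic_model) p"
  obtain t where t: "t > 0" "p = conic_point t"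
    using conic_model_eq_conic_point[OF p] by blast
  let ?s = "1 + t + t^2"
  have s: "?s > 0"
    using t(1) by (simp add: add_pos_pos)
  let ?h = "\<lambda>r. moment u * ln r - ln (1 + r + r^2)"
  have "(?h has_real_derivative (moment u / t - (1 + 2 * t) / ?s)) (at t)"
    using t(1) s by (auto intro!: derivative_eq_intros simp: divide_simps)
  moreover have "?h r \<le> ?h t" if "r > 0" for r
    using max conic_point_in_conic_model[OF that] that t
    by (auto simp: is_arg_max_def not_less loglik_conic_point[OF _ open_simplex_sum[OF u]])
  then have "\<forall>r. \<bar>t - r\<bar> < t \<longrightarrow> ?h r \<le> ?h t"
    by auto
  ultimately have "moment u / t - (1 + 2 * t) / ?s = 0"
    using t(1) DERIV_local_max by blast
  then have "moment u = (t + 2 * t^2) / ?s"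
    using t(1) s by (simp add: field_simps power2_eq_square)
  also have "\<dots> = moment p"
    by (simp add: t(2) moment_def add_divide_distrib)
  finally show "moment u = moment p" .
qed

lemma log_normal_space_iff_moments_agree:
  assumes u: "u \<in> open_simplex" and p: "p \<in> conic_model"
  shows "u \<in> log_normal_space conic_model p \<longleftrightarrow> moment u = moment p"
proof -
  have "u \<in> log_normal_space conic_model p \<longleftrightarrow>
      (\<forall>v\<in>tangent_space conic_model p. (\<Sum>i\<in>UNIV. grad_loglik u p $ i * v $ i) = 0)"
    by (simp add: log_normal_space_def orthogonal_comp_def orthogonal_def inner_vec_def
        mult.commute)
  also have "\<dots> \<longleftrightarrow> moment u = moment p"
  proof (rule score_zero_iff_moments_agree)
    show "conic_model \<subseteq> conic"
      by (auto simp: conic_model_iff)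
    show "conic_point (of_real r) \<in> conic_model" if "r > 0" for r
      using conic_point_in_conic_model[OF that] by simp
    show "p \<in> conic" "p $ 1 \<noteq> 0" "p $ 2 \<noteq> 0" "p $ 3 \<noteq> 0"
      using p by (auto simp: conic_model_iff)
  qed (rule open_simplex_sum[OF u])
  finally show ?thesis .
qed

theorem theorem7:
  shows "has_ML_degree conic_model 2 \<and>
    (\<forall>p\<in>conic_model.
       log_voronoi conic_model p = log_normal_space conic_model p \<inter> open_simplex)"
proof (intro conjI ballI)
  have "open_simplex \<noteq> ({} :: (real ^ 3) set)"
    using conic_point_in_conic_model[of 1] by (auto simp: conic_model_def)
  then show "has_ML_degree conic_model 2"
    unfolding has_ML_degree_def using card_critical_points_conic_model
    by (intro exI[of _ "\<lambda>_. 1"]) (auto intro: poly_map.const)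
next
  fix p :: "real ^ 3" assume "p \<in> conic_model"
  then show "log_voronoi conic_model p = log_normal_space conic_model p \<inter> open_simplex"
    using is_arg_max_iff_moments_agree log_normal_space_iff_moments_agree
    by (auto simp: log_voronoi_def)
qed

end
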